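(* Let $B\subseteq\mathbb{R}^S$ be a nonempty integral base-polyhedron and $\dot B=B\cap\mathbb{Z}^S$. The minimum norm point of $B$ can be represented as a convex combination of the decreasingly minimal elements of $\dot B$.
   Context: $S$ is a finite nonempty set. An integral base-polyhedron is $B=\{x\in\mathbb{R}^S: \widetilde x(S)=p(S),\ \widetilde x(Z)\ge p(Z)\ \forall Z\subset S\}$ for an integer-valued supermodular $p:2^S\to\mathbb{Z}\cup\{-\infty\}$ with $p(\emptyset)=0$, $p(S)$ finite, where $\widetilde x(Z)=\sum_{v\in Z}x(v)$. The minimum norm point of $B$ is the unique minimizer of $\sum_{s\in S}x(s)^2$ over $B$. For a vector $x$, $x{\downarrow}$ is its components sorted decreasingly; $x$ is decreasingly smaller than $y$ if $x{\downarrow}\ne y{\downarrow}$ and $x{\downarrow}(j)<y{\downarrow}(j)$ at the first index $j$ of difference; $m\in\dot B$ is decreasingly minimal if no $y\in\dot B$ is decreasingly smaller than $m$. *)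

theory Defs
  imports "HOL-Analysis.Analysis" "HOL-Library.Multiset" "HOL-Library.Extended_Real"
begin

text \<open>The ground set \<open>S\<close> is the finite index type \<open>'s\<close>, so that \<open>\<real>\<^sup>S\<close> is \<open>real ^ 's\<close>.\<close>

text \<open>The values of a set function lie in \<open>\<int> \<union> {-\<infinity>}\<close>. As \<open>\<infinity>\<close> is never a value,
  \<open>ereal\<close> addition gives the usual reading of the supermodular inequality: it is void
  when \<open>p X\<close> or \<open>p Y\<close> is \<open>-\<infinity>\<close>.\<close>

definition integer_valued :: "('s set \<Rightarrow> ereal) \<Rightarrow> bool" where
  "integer_valued p \<longleftrightarrow> (\<forall>Z. p Z = - \<infinity> \<or> (\<exists>k::int. p Z = ereal (real_of_int k)))"

definition supermodular :: "('s set \<Rightarrow> ereal) \<Rightarrow> bool" where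
  "supermodular p \<longleftrightarrow> (\<forall>X Y. p X + p Y \<le> p (X \<inter> Y) + p (X \<union> Y))"

definition base_polyhedron :: "('s::finite set \<Rightarrow> ereal) \<Rightarrow> (real ^ 's) set" where
  "base_polyhedron p =
    {x. ereal (\<Sum>v\<in>UNIV. x $ v) = p UNIV \<and> (\<forall>Z. ereal (\<Sum>v\<in>Z. x $ v) \<ge> p Z)}"

definition integral_base_polyhedron :: "(real ^ 's::finite) set \<Rightarrow> bool" where
  "integral_base_polyhedron B \<longleftrightarrow>
    (\<exists>p. integer_valued p \<and> supermodular p \<and> p {} = 0 \<and> p UNIV \<noteq> - \<infinity> \<and> B = base_polyhedron p)"

definition integral_points :: "(real ^ 's::finite) set \<Rightarrow> (real ^ 's) set" where
  "integral_points B = {x \<in> B. \<forall>s. x $ s \<in> \<int>}"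

definition dec_sort :: "real ^ 's::finite \<Rightarrow> real list" where
  "dec_sort x = rev (sorted_list_of_multiset (image_mset (\<lambda>s. x $ s) (mset_set UNIV)))"

definition dec_smaller :: "real ^ 's::finite \<Rightarrow> real ^ 's \<Rightarrow> bool" where
  "dec_smaller x y \<longleftrightarrow>
    (\<exists>j < CARD('s). (\<forall>i < j. dec_sort x ! i = dec_sort y ! i) \<and> dec_sort x ! j < dec_sort y ! j)"

definition dec_min :: "(real ^ 's::finite) set \<Rightarrow> real ^ 's \<Rightarrow> bool" where
  "dec_min D m \<longleftrightarrow> m \<in> D \<and> \<not> (\<exists>y\<in>D. dec_smaller y m)"

definition is_min_norm_point :: "(real ^ 's::finite) set \<Rightarrow> real ^ 's \<Rightarrow> bool" where
  "is_min_norm_point B x \<longleftrightarrow>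
    x \<in> B \<and> (\<forall>y\<in>B. (\<Sum>s\<in>UNIV. (x $ s)\<^sup>2) \<le> (\<Sum>s\<in>UNIV. (y $ s)\<^sup>2))"

definition min_norm_point :: "(real ^ 's::finite) set \<Rightarrow> real ^ 's" where
  "min_norm_point B = (THE x. is_min_norm_point B x)"

lemma is_min_norm_point_iff:
  "is_min_norm_point B x \<longleftrightarrow> x \<in> B \<and> (\<forall>y\<in>B. dist 0 x \<le> dist 0 y)"
  by (simp add: is_min_norm_point_def norm_vec_def L2_set_def)

lemma closed_base_polyhedron:
  fixes p :: "'s::finite set \<Rightarrow> ereal"
  assumes "integer_valued p"
  shows "closed (base_polyhedron p)"
proof -
  have 1: "closed {x::real^'s. ereal (\<Sum>v\<in>Z. x $ v) \<ge> p Z}" for Z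
  proof (cases "p Z = - \<infinity>")
    case False
    then obtain k :: int where "p Z = ereal (real_of_int k)"
      using assms by (auto simp: integer_valued_def)
    then show ?thesis by (simp, intro closed_Collect_le continuous_intros)
  qed simp
  have 2: "closed {x::real^'s. ereal (\<Sum>v\<in>UNIV. x $ v) = p UNIV}"
  proof (cases "p UNIV = - \<infinity>")
    case False
    then obtain k :: int where "p UNIV = ereal (real_of_int k)"
      using assms by (auto simp: integer_valued_def)
    then show ?thesis by (simp, intro closed_Collect_eq continuous_intros)
  qed simp
  show ?thesis
    unfolding base_polyhedron_def by (intro closed_Collect_conj closed_Collect_all 1 2)
qed

lemma convex_base_polyhedron:
  fixes p :: "'s::finite set \<Rightarrow> ereal"
  assumes "integer_valued p"
  shows "convex (base_polyhedron p)"
proof (rule convexI)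
  fix x y :: "real^'s" and u v :: real
  assume x: "x \<in> base_polyhedron p" and y: "y \<in> base_polyhedron p"
    and uv: "0 \<le> u" "0 \<le> v" "u + v = 1"
  have lin: "(\<Sum>s\<in>Z. (u *\<^sub>R x + v *\<^sub>R y) $ s) = u * (\<Sum>s\<in>Z. x $ s) + v * (\<Sum>s\<in>Z. y $ s)" for Z
    by (simp add: sum.distrib sum_distrib_left)
  have 1: "ereal (\<Sum>s\<in>Z. (u *\<^sub>R x + v *\<^sub>R y) $ s) \<ge> p Z" for Z
  proof (cases "p Z = - \<infinity>")
    case False
    then obtain k :: int where k: "p Z = ereal (real_of_int k)"
      using assms by (auto simp: integer_valued_def)
    then have "(\<Sum>s\<in>Z. x $ s) \<ge> k" "(\<Sum>s\<in>Z. y $ s) \<ge> k"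
      using x y unfolding base_polyhedron_def by (auto dest: spec[of _ Z])
    then have "u * (\<Sum>s\<in>Z. x $ s) + v * (\<Sum>s\<in>Z. y $ s) \<ge> u * k + v * k"
      using uv by (intro add_mono mult_left_mono) auto
    moreover have "u * k + v * k = k" using uv by (simp flip: distrib_right)
    ultimately show ?thesis unfolding lin k by simp
  qed simp
  have "(\<Sum>s\<in>UNIV. y $ s) = (\<Sum>s\<in>UNIV. x $ s)"
  proof -
    have "ereal (\<Sum>s\<in>UNIV. y $ s) = ereal (\<Sum>s\<in>UNIV. x $ s)"
      using x y unfolding base_polyhedron_def by simp
    then show ?thesis by simp
  qed
  then have "(\<Sum>s\<in>UNIV. (u *\<^sub>R x + v *\<^sub>R y) $ s) = (\<Sum>s\<in>UNIV. x $ s)"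
    unfolding lin using uv by (simp flip: distrib_right)
  then have 2: "ereal (\<Sum>s\<in>UNIV. (u *\<^sub>R x + v *\<^sub>R y) $ s) = p UNIV"
    using x unfolding base_polyhedron_def by simp
  show "u *\<^sub>R x + v *\<^sub>R y \<in> base_polyhedron p"
    unfolding base_polyhedron_def using 1 2 by blast
qed

lemma ex1_min_norm_point:
  assumes "integral_base_polyhedron B" "B \<noteq> {}"
  shows "\<exists>!x. is_min_norm_point B x"
proof -
  have B: "closed B" "convex B"
    using assms(1) closed_base_polyhedron convex_base_polyhedron
    by (auto simp: integral_base_polyhedron_def)
  show ?thesis
  proof
    show "is_min_norm_point B (closest_point B 0)"
      unfolding is_min_norm_point_iff using closest_point_exists[OF B(1) assms(2)] by blast
  next
    fix x assume "is_min_norm_point B x"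
    then show "x = closest_point B 0"
      unfolding is_min_norm_point_iff using closest_point_unique[OF B(2,1)] by blast
  qed
qed

lemma length_dec_sort: "length (dec_sort (x :: real ^ 's::finite)) = CARD('s)"
  by (simp add: dec_sort_def flip: size_mset)

end

theory Submission
  imports Defs
begin

text \<open>
  Let \<open>x\<close> be the minimum norm point. Since no exchange towards smaller components is possible at
  \<open>x\<close>, uncrossing shows that every level set \<open>{x > c}\<close> is tight. Let \<open>F\<close> be the polytope of
  those \<open>y \<in> B\<close> that satisfy \<open>\<lfloor>x\<rfloor> \<le> y \<le> \<lceil>x\<rceil>\<close> and for which the level sets
  \<open>{x > k}\<close>, \<open>k\<close> integer, remain tight; it contains \<open>x\<close>. Its extreme points are
  integral: a fractional component \<open>t\<close> has a fractional companion \<open>s\<close> lying in the same tight sets,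
  because the atom of the lattice of tight sets around \<open>t\<close> has integral sum, and then one can move
  in both directions along \<open>e\<^sub>s - e\<^sub>t\<close>. Finally, an integral \<open>z \<in> F\<close> is decreasingly minimal:
  for integral \<open>k\<close> one has
  \<open>\<Sum> max (z(s) - k) 0 = p {x > k} - k |{x > k}|\<close>, which is a lower bound for
  \<open>\<Sum> max (y(s) - k) 0\<close> for every \<open>y \<in> B\<close>; a decreasingly smaller \<open>y\<close> would violate
  this at the value \<open>k\<close> of \<open>y\<down>\<close> at the first difference.
\<close>

section \<open>Decreasing order and majorization\<close>

lemma sum_dec_sort:
  fixes x :: "real ^ 's::finite" and f :: "real \<Rightarrow> real"
  shows "(\<Sum>s\<in>UNIV. f (x $ s)) = (\<Sum>i<CARD('s). f (dec_sort x ! i))"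
proof -
  have "(\<Sum>s\<in>UNIV. f (x $ s)) = sum_mset (image_mset f (mset (dec_sort x)))"
    by (simp add: dec_sort_def sum_unfold_sum_mset image_mset.compositionality comp_def)
  also have "\<dots> = sum_list (map f (dec_sort x))"
    by (simp flip: mset_map sum_mset_sum_list)
  also have "\<dots> = (\<Sum>i<CARD('s). f (dec_sort x ! i))"
    by (simp add: sum_list_sum_nth length_dec_sort atLeast0LessThan)
  finally show ?thesis .
qed

lemma dec_sort_antimono:
  fixes x :: "real ^ 's::finite"
  assumes "i \<le> j" "j < CARD('s)"
  shows "dec_sort x ! j \<le> dec_sort x ! i"
  using assms length_dec_sort[of x]
  by (auto simp: dec_sort_def rev_nth intro!: sorted_nth_mono)

lemma dec_sort_in_range:
  fixes x :: "real ^ 's::finite"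
  assumes "j < CARD('s)"
  shows "dec_sort x ! j \<in> range (($) x)"
proof -
  have "dec_sort x ! j \<in> set (dec_sort x)"
    using assms by (simp add: length_dec_sort)
  then show ?thesis by (simp add: dec_sort_def)
qed

text \<open>Take \<open>c\<close> to be the entry of the sorted \<open>y\<close> at the first
  difference \<open>j\<close>. Before \<open>j\<close> both vectors exceed \<open>c\<close> equally,
  from \<open>j\<close> on \<open>y\<close> contributes nothing, and \<open>z\<close> gains strictly
  at \<open>j\<close>. Only components of \<open>y\<close> serve as thresholds, so \<open>c\<close>
  is an integer when \<open>y\<close> is integral.\<close>

lemma not_dec_smaller_if_majorized:
  fixes y z :: "real ^ 's::finite"
  assumes "\<And>c. c \<in> range (($) y) \<Longrightarrow>
    (\<Sum>s\<in>UNIV. max (z $ s - c) 0) \<le> (\<Sum>s\<in>UNIV. max (y $ s - c) 0)"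
  shows "\<not> dec_smaller y z"
proof
  assume "dec_smaller y z"
  then obtain j where j: "j < CARD('s)" "\<forall>i<j. dec_sort y ! i = dec_sort z ! i"
    "dec_sort y ! j < dec_sort z ! j"
    by (auto simp: dec_smaller_def)
  define c where "c = dec_sort y ! j"
  have "(\<Sum>i<CARD('s). max (dec_sort y ! i - c) 0) < (\<Sum>i<CARD('s). max (dec_sort z ! i - c) 0)"
  proof (rule sum_strict_mono_ex1)
    show "\<forall>i\<in>{..<CARD('s)}. max (dec_sort y ! i - c) 0 \<le> max (dec_sort z ! i - c) 0"
    proof
      fix i assume i: "i \<in> {..<CARD('s)}"
      show "max (dec_sort y ! i - c) 0 \<le> max (dec_sort z ! i - c) 0"
      proof (cases "i < j")
        case False
        then have "dec_sort y ! i \<le> c"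
          using dec_sort_antimono[of j i y] i by (simp add: c_def)
        then show ?thesis by simp
      qed (simp add: j)
    qed
    show "\<exists>i\<in>{..<CARD('s)}. max (dec_sort y ! i - c) 0 < max (dec_sort z ! i - c) 0"
      using j by (intro bexI[of _ j]) (auto simp: c_def)
  qed simp
  then show False
    using assms[of c] dec_sort_in_range[OF j(1), of y]
    by (simp add: c_def sum_dec_sort[where f = "\<lambda>v. max (v - _) 0"])
qed

section \<open>Tight sets and exchanges\<close>

definition tight :: "('s::finite set \<Rightarrow> ereal) \<Rightarrow> real ^ 's \<Rightarrow> 's set \<Rightarrow> bool" where
  "tight p x Z \<longleftrightarrow> ereal (\<Sum>v\<in>Z. x $ v) = p Z"

text \<open>An exchange: \<open>d\<close> units are moved from component \<open>t\<close> to
  component \<open>s\<close>.\<close>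

definition shift :: "'s \<Rightarrow> 's \<Rightarrow> real \<Rightarrow> real ^ 's \<Rightarrow> real ^ 's::finite" where
  "shift t s d x = x + d *\<^sub>R (axis s 1 - axis t 1)"

lemma shift_nth:
  "shift t s d x $ v = x $ v + d * (of_bool (v = s) - of_bool (v = t))"
  by (auto simp: shift_def axis_def)

lemma sum_shift:
  "(\<Sum>v\<in>Z. shift t s d x $ v) = (\<Sum>v\<in>Z. x $ v) + d * (of_bool (s \<in> Z) - of_bool (t \<in> Z))"
  by (simp add: shift_nth sum.distrib sum_subtractf flip: sum_distrib_left)

locale integral_base =
  fixes p :: "'s::finite set \<Rightarrow> ereal"
  assumes int_p: "integer_valued p"
    and sup_p: "supermodular p"
    and p_empty: "p {} = 0"
begin

abbreviation B :: "(real ^ 's) set" where "B \<equiv> base_polyhedron p"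

lemma p_le_sum: "x \<in> B \<Longrightarrow> p Z \<le> ereal (\<Sum>v\<in>Z. x $ v)"
  by (simp add: base_polyhedron_def)

lemma tight_UNIV: "x \<in> B \<Longrightarrow> tight p x UNIV"
  by (simp add: base_polyhedron_def tight_def)

lemma tight_empty: "tight p x {}"
  by (simp add: tight_def p_empty)

text \<open>Uncrossing: component sums are modular and \<open>p\<close> is supermodular, so the
  nonnegative slacks of the intersection and the union add up to at most zero. The case split also
  rules out infinite values.\<close>

lemma tight_Int_Un:
  assumes "x \<in> B" "tight p x X" "tight p x Y"
  shows "tight p x (X \<inter> Y) \<and> tight p x (X \<union> Y)"
proof -
  have "p X + p Y \<le> p (X \<inter> Y) + p (X \<union> Y)"
    using sup_p by (simp add: supermodular_def)
  then have 1: "ereal (\<Sum>v\<in>X. x $ v) + ereal (\<Sum>v\<in>Y. x $ v) \<le> p (X \<inter> Y) + p (X \<union> Y)"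
    using assms by (simp add: tight_def)
  have 2: "(\<Sum>v\<in>X. x $ v) + (\<Sum>v\<in>Y. x $ v) = (\<Sum>v\<in>X \<inter> Y. x $ v) + (\<Sum>v\<in>X \<union> Y. x $ v)"
    using sum.union_inter[of X Y "($) x"] by simp
  show ?thesis
    using 1 2 p_le_sum[OF assms(1), of "X \<inter> Y"] p_le_sum[OF assms(1), of "X \<union> Y"]
    unfolding tight_def by (cases "p (X \<inter> Y)"; cases "p (X \<union> Y)") auto
qed

lemma tight_Inter:
  assumes "x \<in> B" "\<And>Z. Z \<in> \<Z> \<Longrightarrow> tight p x Z"
  shows "tight p x (\<Inter>\<Z>)"
proof -
  have "finite \<Z>" by simp
  then show ?thesis using assms(2)
  proof (induction \<Z> rule: finite_induct)
    case empty
    show ?case using tight_UNIV[OF assms(1)] by simp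
  next
    case (insert Z \<Z>)
    have "tight p x Z" "tight p x (\<Inter>\<Z>)" using insert.IH insert.prems by blast+
    then show ?case using tight_Int_Un[OF assms(1)] by simp
  qed
qed

lemma tight_Union:
  assumes "x \<in> B" "\<And>Z. Z \<in> \<Z> \<Longrightarrow> tight p x Z"
  shows "tight p x (\<Union>\<Z>)"
proof -
  have "finite \<Z>" by simp
  then show ?thesis using assms(2)
  proof (induction \<Z> rule: finite_induct)
    case empty
    show ?case using tight_empty by simp
  next
    case (insert Z \<Z>)
    have "tight p x Z" "tight p x (\<Union>\<Z>)" using insert.IH insert.prems by blast+
    then show ?case using tight_Int_Un[OF assms(1)] by simp
  qed
qed

lemma tight_sum_Ints:
  assumes "tight p x Z"
  shows "(\<Sum>v\<in>Z. x $ v) \<in> \<int>"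
proof -
  have "p Z \<noteq> - \<infinity>" using assms by (auto simp: tight_def)
  then obtain k :: int where "p Z = ereal (real_of_int k)"
    using int_p unfolding integer_valued_def by blast
  then show ?thesis using assms by (simp add: tight_def)
qed

text \<open>Tight sets never lose under the move, as those containing \<open>t\<close> contain
  \<open>s\<close>. Every other set has positive slack, and there are finitely many sets.\<close>

lemma exchange:
  assumes x: "x \<in> B" and ts: "\<And>Z. tight p x Z \<Longrightarrow> t \<in> Z \<Longrightarrow> s \<in> Z"
  obtains e where "e > 0" "\<And>d. 0 \<le> d \<Longrightarrow> d \<le> e \<Longrightarrow> shift t s d x \<in> B"
proof -
  have "\<exists>e>0. \<forall>d. 0 \<le> d \<and> d \<le> e \<longrightarrow> p Z \<le> ereal (\<Sum>v\<in>Z. shift t s d x $ v)" for Z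
  proof (cases "tight p x Z")
    case True
    then have "d \<ge> 0 \<Longrightarrow> p Z \<le> ereal (\<Sum>v\<in>Z. shift t s d x $ v)" for d
      using ts[of Z] p_le_sum[OF x, of Z] unfolding sum_shift
      by (intro order_trans[OF p_le_sum[OF x]]) (auto simp: of_bool_def)
    then show ?thesis by (intro exI[of _ 1]) auto
  next
    case False
    then have lt: "p Z < ereal (\<Sum>v\<in>Z. x $ v)"
      using p_le_sum[OF x, of Z] by (auto simp: tight_def)
    show ?thesis
    proof (cases "p Z")
      case (real r)
      then show ?thesis using lt unfolding sum_shift
        \<comment> \<open>The slack of \<open>Z\<close>: the move lowers the sum over
          \<open>Z\<close> by at most \<open>d\<close>.\<close>
        by (intro exI[of _ "(\<Sum>v\<in>Z. x $ v) - r"]) (auto simp: of_bool_def)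
    next
      case MInf
      then show ?thesis by (intro exI[of _ 1]) simp
    qed (use lt in simp)
  qed
  then obtain e where e: "\<And>Z. e Z > 0"
    "\<And>Z d. 0 \<le> d \<Longrightarrow> d \<le> e Z \<Longrightarrow> p Z \<le> ereal (\<Sum>v\<in>Z. shift t s d x $ v)"
    by metis
  show ?thesis
  proof
    show "Min (range e) > 0" using e(1) by simp
    show "shift t s d x \<in> B" if "0 \<le> d" "d \<le> Min (range e)" for d
    proof -
      have "p Z \<le> ereal (\<Sum>v\<in>Z. shift t s d x $ v)" for Z
        using that by (intro e(2)) auto
      moreover have "ereal (\<Sum>v\<in>UNIV. shift t s d x $ v) = p UNIV"
        using tight_UNIV[OF x] unfolding sum_shift tight_def by simp
      ultimately show ?thesis by (simp add: base_polyhedron_def)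
    qed
  qed
qed

text \<open>\<open>D\<close> is the least tight set containing \<open>t\<close>, and
  \<open>U\<close> the largest tight subset of \<open>D\<close> avoiding \<open>t\<close>. No tight
  set splits \<open>D - U\<close>, and its sum is a difference of two integers.\<close>

lemma atom:
  assumes x: "x \<in> B"
  obtains A where "t \<in> A" "(\<Sum>v\<in>A. x $ v) \<in> \<int>"
    "\<And>s Z. s \<in> A \<Longrightarrow> tight p x Z \<Longrightarrow> s \<in> Z \<longleftrightarrow> t \<in> Z"
proof -
  define D where "D = \<Inter>{Z. tight p x Z \<and> t \<in> Z}"
  define U where "U = \<Union>{Z. tight p x Z \<and> t \<notin> Z \<and> Z \<subseteq> D}"
  have D: "tight p x D" "t \<in> D" unfolding D_def by (auto intro!: tight_Inter x)
  have U: "tight p x U" "t \<notin> U" "U \<subseteq> D" unfolding U_def by (auto intro!: tight_Union x)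
  have "(\<Sum>v\<in>D - U. x $ v) = (\<Sum>v\<in>D. x $ v) - (\<Sum>v\<in>U. x $ v)"
    using U by (simp add: sum_diff)
  then have "(\<Sum>v\<in>D - U. x $ v) \<in> \<int>"
    using D U by (simp add: tight_sum_Ints)
  moreover have "s \<in> Z \<longleftrightarrow> t \<in> Z" if s: "s \<in> D - U" and Z: "tight p x Z" for s Z
  proof
    assume "t \<in> Z" then show "s \<in> Z" using s Z by (auto simp: D_def)
  next
    assume "s \<in> Z"
    \<comment> \<open>If \<open>t\<close> were not in \<open>Z\<close>, this tight set would lie
      inside \<open>U\<close>, yet it contains \<open>s\<close>.\<close>
    have "tight p x (Z \<inter> D)" using tight_Int_Un[OF x Z D(1)] by simp
    then show "t \<in> Z" using s \<open>s \<in> Z\<close> by (auto simp: U_def)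
  qed
  moreover have "t \<in> D - U" using D U by simp
  ultimately show ?thesis using that by blast
qed

section \<open>Level sets of the minimum norm point\<close>

text \<open>Otherwise a small move from \<open>t\<close> to \<open>s\<close> stays in
  \<open>B\<close> and lowers the sum of squares.\<close>

lemma min_norm_separating_tight:
  assumes "is_min_norm_point B x" "x $ s < x $ t"
  shows "\<exists>Z. tight p x Z \<and> t \<in> Z \<and> s \<notin> Z"
proof (rule ccontr)
  assume "\<not> ?thesis"
  then have "\<And>Z. tight p x Z \<Longrightarrow> t \<in> Z \<Longrightarrow> s \<in> Z" by blast
  moreover have "x \<in> B" using assms(1) by (simp add: is_min_norm_point_def)
  ultimately obtain e
    where e: "e > 0" "\<And>d. 0 \<le> d \<Longrightarrow> d \<le> e \<Longrightarrow> shift t s d x \<in> B"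
    using exchange[of x t s] by metis
  \<comment> \<open>The squared norm changes by \<open>- 2 * d * (x $ t - x $ s - d)\<close>; half
    the gap keeps the last factor positive.\<close>
  define d where "d = min e ((x $ t - x $ s) / 2)"
  have d: "d > 0" "d \<le> e" "d < x $ t - x $ s" using e(1) assms(2) by (auto simp: d_def min_def)
  have sq: "(a + b)\<^sup>2 = a\<^sup>2 + (2 * b * a + b\<^sup>2)" for a b :: real
    by (simp add: power2_sum)
  have "(\<Sum>v\<in>UNIV. (shift t s d x $ v)\<^sup>2)
      = (\<Sum>v\<in>UNIV. (x $ v)\<^sup>2 + (if v = s then 2 * d * x $ s + d\<^sup>2 else 0)
          - (if v = t then 2 * d * x $ t - d\<^sup>2 else 0))"
    using assms(2) by (intro sum.cong refl) (auto simp: shift_nth sq)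
  also have "\<dots> = (\<Sum>v\<in>UNIV. (x $ v)\<^sup>2) + (2 * d * x $ s + d\<^sup>2) - (2 * d * x $ t - d\<^sup>2)"
    by (simp add: sum.distrib sum_subtractf)
  also have "\<dots> = (\<Sum>v\<in>UNIV. (x $ v)\<^sup>2) - 2 * d * (x $ t - x $ s - d)"
    by (simp add: power2_eq_square algebra_simps)
  also have "\<dots> < (\<Sum>v\<in>UNIV. (x $ v)\<^sup>2)" using d by simp
  finally show False
    using assms(1) e(2)[of d] d by (simp add: is_min_norm_point_def flip: not_less)
qed

text \<open>For \<open>t\<close> in the level set, intersecting the tight sets that separate it from
  each outside point gives a tight set around \<open>t\<close> within the level set. The union of
  these over all \<open>t\<close> is the level set.\<close>

lemma min_norm_level_tight:
  assumes "is_min_norm_point B x"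
  shows "tight p x {s. x $ s > c}"
proof -
  have x: "x \<in> B" using assms by (simp add: is_min_norm_point_def)
  define L where "L = {s. x $ s > c}"
  have "\<exists>Z. tight p x Z \<and> t \<in> Z \<and> Z \<subseteq> L" if t: "t \<in> L" for t
  proof -
    have "\<forall>s\<in>-L. \<exists>Z. tight p x Z \<and> t \<in> Z \<and> s \<notin> Z"
      using t by (auto simp: L_def intro!: min_norm_separating_tight[OF assms])
    then obtain Z where Z: "\<And>s. s \<in> -L \<Longrightarrow> tight p x (Z s) \<and> t \<in> Z s \<and> s \<notin> Z s"
      by metis
    have "tight p x (\<Inter>(Z ` (-L)))" using Z by (intro tight_Inter x) auto
    then show ?thesis using Z by (intro exI[of _ "\<Inter>(Z ` (-L))"]) auto
  qed
  then have "L = \<Union>{Z. tight p x Z \<and> Z \<subseteq> L}" by blast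
  moreover have "tight p x (\<Union>{Z. tight p x Z \<and> Z \<subseteq> L})" by (intro tight_Union x) auto
  ultimately show ?thesis by (simp add: L_def)
qed

section \<open>The box face around a point\<close>

text \<open>The level constraints are linear equations in \<open>y\<close>. When the level sets are
  tight at \<open>x\<close>, these equations say that they are tight at \<open>y\<close>. Integer
  levels suffice because the box has integral bounds.\<close>

definition box_face :: "real ^ 's \<Rightarrow> (real ^ 's) set" where
  "box_face x = {y \<in> B. (\<forall>s. real_of_int \<lfloor>x $ s\<rfloor> \<le> y $ s \<and> y $ s \<le> real_of_int \<lceil>x $ s\<rceil>) \<and>
     (\<forall>k::int. (\<Sum>s | x $ s > k. y $ s) = (\<Sum>s | x $ s > k. x $ s))}"

lemma box_face_eq:
  "box_face x = B \<inter> cbox (\<chi> s. real_of_int \<lfloor>x $ s\<rfloor>) (\<chi> s. real_of_int \<lceil>x $ s\<rceil>) \<inter>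
    (\<Inter>k::int. {y. (\<Sum>s | x $ s > k. y $ s) = (\<Sum>s | x $ s > k. x $ s)})"
  by (auto simp: box_face_def mem_box_cart)

lemma compact_box_face: "compact (box_face x)"
proof -
  have "closed {y::real^'s. (\<Sum>s | x $ s > k. y $ s) = (\<Sum>s | x $ s > k. x $ s)}" for k
    by (intro closed_Collect_eq continuous_intros)
  then show ?thesis unfolding box_face_eq
    by (intro compact_Int_closed closed_Int_compact compact_cbox closed_base_polyhedron int_p
        closed_INT) auto
qed

lemma convex_box_face: "convex (box_face x)"
proof -
  have "convex {y::real^'s. (\<Sum>s\<in>Z. y $ s) = r}" for Z r
  proof (rule convexI)
    fix y z :: "real^'s" and u v :: real
    assume "y \<in> {y. (\<Sum>s\<in>Z. y $ s) = r}" "z \<in> {y. (\<Sum>s\<in>Z. y $ s) = r}" "u + v = 1"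
    then show "u *\<^sub>R y + v *\<^sub>R z \<in> {y. (\<Sum>s\<in>Z. y $ s) = r}"
      by (simp add: sum.distrib flip: sum_distrib_left distrib_right)
  qed
  then show ?thesis unfolding box_face_eq
    by (intro convex_Int convex_INT convex_base_polyhedron int_p) auto
qed

text \<open>Fractional components lie strictly inside their integral bounds, which leaves room to
  move. The level sets are tight at \<open>y\<close>, so none separates \<open>s\<close> from
  \<open>t\<close> and their sums are preserved.\<close>

lemma shift_in_box_face:
  assumes lev: "\<And>k::int. tight p x {s. x $ s > k}"
    and y: "y \<in> box_face x" and frac: "y $ t \<notin> \<int>" "y $ s \<notin> \<int>" and "s \<noteq> t"
    and eq: "\<And>Z. tight p y Z \<Longrightarrow> s \<in> Z \<longleftrightarrow> t \<in> Z"
  obtains e where "e > 0" "\<And>d. 0 \<le> d \<Longrightarrow> d \<le> e \<Longrightarrow> shift t s d y \<in> box_face x"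
proof -
  have yB: "y \<in> B" and sumy: "\<And>k::int. (\<Sum>s | x $ s > k. y $ s) = (\<Sum>s | x $ s > k. x $ s)"
    and bd: "\<And>v. real_of_int \<lfloor>x $ v\<rfloor> \<le> y $ v" "\<And>v. y $ v \<le> real_of_int \<lceil>x $ v\<rceil>"
    using y by (auto simp: box_face_def)
  obtain e where e: "e > 0" "\<And>d. 0 \<le> d \<Longrightarrow> d \<le> e \<Longrightarrow> shift t s d y \<in> B"
    using exchange[OF yB, of t s] eq by blast
  have "real_of_int \<lfloor>x $ t\<rfloor> \<noteq> y $ t" "y $ s \<noteq> real_of_int \<lceil>x $ s\<rceil>"
    using frac by (metis Ints_of_int)+
  then have lt: "real_of_int \<lfloor>x $ t\<rfloor> < y $ t" "y $ s < real_of_int \<lceil>x $ s\<rceil>"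
    using bd by (auto simp: order_less_le)
  define e' where "e' = min e (min (y $ t - \<lfloor>x $ t\<rfloor>) (\<lceil>x $ s\<rceil> - y $ s))"
  show ?thesis
  proof
    show "e' > 0" using e lt by (simp add: e'_def)
    fix d assume d: "0 \<le> d" "d \<le> e'"
    have "tight p y {s. x $ s > k}" for k :: int
      using lev[of k] sumy[of k] by (simp add: tight_def)
    then have "(\<Sum>v | x $ v > k. shift t s d y $ v) = (\<Sum>v | x $ v > k. x $ v)" for k :: int
      unfolding sum_shift using eq[of "{s. x $ s > k}"] sumy[of k] by (simp add: of_bool_def)
    moreover have "real_of_int \<lfloor>x $ v\<rfloor> \<le> shift t s d y $ v \<and> shift t s d y $ v \<le> \<lceil>x $ v\<rceil>" for v
      using d bd[of v] \<open>s \<noteq> t\<close> by (auto simp: shift_nth of_bool_def e'_def)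
    ultimately show "shift t s d y \<in> box_face x"
      using e(2)[of d] d by (simp add: box_face_def e'_def)
  qed
qed

text \<open>An atom with integral sum cannot have exactly one fractional component. Two of them
  allow opposite exchanges, making \<open>y\<close> the midpoint of a proper segment in the
  face.\<close>

lemma extreme_box_face_integral:
  assumes lev: "\<And>k::int. tight p x {s. x $ s > k}"
    and ext: "y extreme_point_of box_face x"
  shows "y $ t \<in> \<int>"
proof (rule ccontr)
  assume t: "y $ t \<notin> \<int>"
  have y: "y \<in> box_face x" using ext by (simp add: extreme_point_of_def)
  then have yB: "y \<in> B" by (simp add: box_face_def)
  obtain A where A: "t \<in> A" "(\<Sum>v\<in>A. y $ v) \<in> \<int>"
    "\<And>s Z. s \<in> A \<Longrightarrow> tight p y Z \<Longrightarrow> s \<in> Z \<longleftrightarrow> t \<in> Z"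
    using atom[OF yB] by blast
  have "\<exists>s\<in>A - {t}. y $ s \<notin> \<int>"
  proof (rule ccontr)
    assume "\<not> ?thesis"
    then have "(\<Sum>v\<in>A - {t}. y $ v) \<in> \<int>" by (intro Ints_sum) auto
    moreover have "y $ t = (\<Sum>v\<in>A. y $ v) - (\<Sum>v\<in>A - {t}. y $ v)"
      using A(1) by (simp add: sum.remove)
    ultimately show False using t A(2) by simp
  qed
  then obtain s where s: "s \<in> A" "s \<noteq> t" "y $ s \<notin> \<int>" by auto
  obtain e1 where e1: "e1 > 0" "\<And>d. 0 \<le> d \<Longrightarrow> d \<le> e1 \<Longrightarrow> shift t s d y \<in> box_face x"
    using shift_in_box_face[OF lev y, of t s] t s A(3) by blast
  obtain e2 where e2: "e2 > 0" "\<And>d. 0 \<le> d \<Longrightarrow> d \<le> e2 \<Longrightarrow> shift s t d y \<in> box_face x"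
    using shift_in_box_face[OF lev y, of s t] t s A(3) by blast
  define d where "d = min e1 e2"
  have d: "d > 0" using e1 e2 by (simp add: d_def)
  have "shift t s d y + shift s t d y = 2 *\<^sub>R y"
    by (simp add: shift_def scaleR_2 algebra_simps)
  then have "y = midpoint (shift t s d y) (shift s t d y)"
    by (simp add: midpoint_def)
  moreover have "shift t s d y \<noteq> shift s t d y"
  proof
    assume "shift t s d y = shift s t d y"
    then have "shift t s d y $ s = shift s t d y $ s" by simp
    then show False using d s(2) by (simp add: shift_nth)
  qed
  ultimately have "y \<in> open_segment (shift t s d y) (shift s t d y)"
    by (metis midpoint_in_open_segment)
  then show False
    using ext e1(2)[of d] e2(2)[of d] d by (auto simp: extreme_point_of_def d_def)
qed

lemma integral_box_face_dec_min:
  assumes lev: "\<And>k::int. tight p x {s. x $ s > k}"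
    and z: "z \<in> box_face x" and int: "\<And>s. z $ s \<in> \<int>"
  shows "dec_min (integral_points B) z"
proof -
  have zB: "z \<in> B" and bd: "\<And>v. real_of_int \<lfloor>x $ v\<rfloor> \<le> z $ v" "\<And>v. z $ v \<le> real_of_int \<lceil>x $ v\<rceil>"
    and sumz: "\<And>k::int. (\<Sum>s | x $ s > k. z $ s) = (\<Sum>s | x $ s > k. x $ s)"
    using z by (auto simp: box_face_def)
  have "\<not> dec_smaller y z" if y: "y \<in> integral_points B" for y
  proof (rule not_dec_smaller_if_majorized)
    have yB: "y \<in> B" using y by (simp add: integral_points_def)
    fix c assume "c \<in> range (($) y)"
    then have "c \<in> \<int>" using y by (auto simp: integral_points_def)
    then obtain k :: int where k: "c = real_of_int k" by (auto elim: Ints_cases)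
    define L where "L = {s. x $ s > k}"
    have le: "(\<Sum>s\<in>L. z $ s) \<le> (\<Sum>s\<in>L. y $ s)"
    proof -
      have "ereal (\<Sum>s\<in>L. z $ s) = p L"
        using lev[of k] sumz[of k] by (simp add: tight_def L_def)
      also have "\<dots> \<le> ereal (\<Sum>s\<in>L. y $ s)" by (rule p_le_sum[OF yB])
      finally show ?thesis by simp
    qed
    \<comment> \<open>As \<open>k\<close> is an integer, rounding \<open>x\<close> preserves its
      side of \<open>k\<close>: the box forces \<open>z\<close> to be at least \<open>k\<close> on
      \<open>L\<close> and at most \<open>k\<close> off \<open>L\<close>.\<close>
    have "max (z $ s - c) 0 = (if s \<in> L then z $ s - c else 0)" for s
    proof (cases "s \<in> L")
      case True
      then have "k \<le> \<lfloor>x $ s\<rfloor>" by (simp add: L_def le_floor_iff)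
      then have "real_of_int k \<le> \<lfloor>x $ s\<rfloor>" by simp
      then show ?thesis using True bd(1)[of s] k by simp
    next
      case False
      then have "\<lceil>x $ s\<rceil> \<le> k" by (simp add: L_def ceiling_le_iff)
      then have "\<lceil>x $ s\<rceil> \<le> real_of_int k" by simp
      then show ?thesis using False bd(2)[of s] k by simp
    qed
    then have "(\<Sum>s\<in>UNIV. max (z $ s - c) 0) = (\<Sum>s\<in>L. z $ s - c)"
      by (simp add: sum.If_cases)
    also have "\<dots> \<le> (\<Sum>s\<in>L. y $ s - c)" using le by (simp add: sum_subtractf)
    also have "\<dots> \<le> (\<Sum>s\<in>L. max (y $ s - c) 0)" by (intro sum_mono) simp
    also have "\<dots> \<le> (\<Sum>s\<in>UNIV. max (y $ s - c) 0)" by (intro sum_mono2) auto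
    finally show "(\<Sum>s\<in>UNIV. max (z $ s - c) 0) \<le> (\<Sum>s\<in>UNIV. max (y $ s - c) 0)" .
  qed
  then show ?thesis using zB int by (auto simp: dec_min_def integral_points_def)
qed

lemma min_norm_point_in_hull_dec_min:
  assumes x: "is_min_norm_point B x"
  shows "x \<in> convex hull {m. dec_min (integral_points B) m}"
proof -
  have lev: "tight p x {s. x $ s > c}" for c by (rule min_norm_level_tight[OF x])
  have "x \<in> box_face x" using x by (simp add: box_face_def is_min_norm_point_def)
  \<comment> \<open>Minkowski's theorem reduces the claim to extreme points, which are integral and
    hence decreasingly minimal.\<close>
  also have "box_face x = convex hull {y. y extreme_point_of box_face x}"
    by (rule Krein_Milman_Minkowski[OF compact_box_face convex_box_face])
  also have "\<dots> \<subseteq> convex hull {m. dec_min (integral_points B) m}"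
  proof (rule hull_mono, safe)
    fix y assume y: "y extreme_point_of box_face x"
    then have "y \<in> box_face x" by (simp add: extreme_point_of_def)
    then show "dec_min (integral_points B) y"
      using lev extreme_box_face_integral[OF lev y] by (intro integral_box_face_dec_min)
  qed
  finally show ?thesis .
qed

end

theorem theorem6p9:
  fixes B :: "(real ^ 's::finite) set"
  assumes "integral_base_polyhedron B"
    and "B \<noteq> {}"
  shows "min_norm_point B \<in> convex hull {m. dec_min (integral_points B) m}"
proof -
  obtain p where p: "integer_valued p" "supermodular p" "p {} = 0" "B = base_polyhedron p"
    using assms(1) by (auto simp: integral_base_polyhedron_def)
  then interpret integral_base p by unfold_locales
  have "is_min_norm_point B (min_norm_point B)"
    unfolding min_norm_point_def by (rule theI'[OF ex1_min_norm_point[OF assms]])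
  then show ?thesis using min_norm_point_in_hull_dec_min p by simp
qed

end
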